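(* Let $R$ be a region in a generalized Ish arrangement in $V_{n-1}$, whose associated weighted digraph has the code $(\sigma,\omega)$. Then a hyperplane is a ceiling hyperplane of $R$ if and only if it satisfies an equation of the form $$x_{1}-x_{\sigma(j)}=\omega(j)^+$$ for some $j\in\{1,\ldots,n\}$ with $\sigma^{-1}(1)<j$ and $\omega(j)^+<\infty$ such that there is no $j'$ satisfying $j<j'$ and $\omega(j)^+\ge\omega(j')^+$.
   Context: $V_{n-1}=\{x\in\mathbb{R}^n: x_1+\cdots+x_n=0\}$. A generalized Ish arrangement in $V_{n-1}$ consists of the hyperplanes $x_i-x_j=c$, $1\le i<j\le n$, $c\in A_{ij}$, where $A_{ij}=\{0\}$ for $1<i<j$ and each $A_{1j}=\{a_{1j}^{(1)}<a_{1j}^{(2)}<\cdots<a_{1j}^{(n_{1j})}\}$ ($2\le j\le n$) is a finite set of real numbers with smallest element $a_{1j}^{(1)}=0$. For $a\in A_{1j}$ put $a^+=a_{1j}^{(k+1)}$ if $a=a_{1j}^{(k)}$ with $k<n_{1j}$, and $a^+=\infty$ if $a=a_{1j}^{(n_{1j})}$. Code of a region $R$: on $R$ the coordinates are in a fixed strict order $x_{\sigma(1)}>x_{\sigma(2)}>\cdots>x_{\sigma(n)}$, which defines the permutation $\sigma$; $\omega=(\omega(1),\ldots,\omega(n))$ has $\omega(j)=0$ for $j\le\sigma^{-1}(1)$, and for $j>\sigma^{-1}(1)$, $\omega(j)\in A_{1,\sigma(j)}$ is the largest element $a$ of $A_{1,\sigma(j)}$ such that $x_1-x_{\sigma(j)}>a$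 on $R$ (so $\omega(j)<x_1-x_{\sigma(j)}<\omega(j)^+$ on $R$, where $\omega(j)^+$ is computed in $A_{1,\sigma(j)}$). Equivalently, in the weighted digraph associated to $R$ the edge $1\rightarrow\sigma(j)$ has weight $\omega(j)$ for $j>\sigma^{-1}(1)$. A hyperplane $H$ of the arrangement is a wall of $R$ if it is the affine span of a facet of the closure of $R$. A wall $H$ is a ceiling of $R$ if $H$ does not contain the origin and $R$ and the origin lie in the same half-space of $H$. *)

theory Defs
  imports "HOL-Analysis.Analysis"
begin

text \<open>
  The index set \<open>{1,\<dots>,n}\<close>, \<open>n \<ge> 1\<close>, is an arbitrary finite linearly ordered type \<open>'n\<close>; its least
  element plays the role of the index 1. The same type serves as the set of positions
  \<open>1,\<dots>,n\<close> in a permutation.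
\<close>

definition first :: "'n::{finite,linorder}" where
  "first = Min UNIV"

definition V :: "(real ^ 'n) set" where
  "V = {x. (\<Sum>i\<in>UNIV. x $ i) = 0}"

definition generalized_ish :: "('n::{finite,linorder} \<Rightarrow> 'n \<Rightarrow> real set) \<Rightarrow> bool" where
  "generalized_ish A \<longleftrightarrow>
     (\<forall>i j. first < i \<and> i < j \<longrightarrow> A i j = {0}) \<and>
     (\<forall>j. first < j \<longrightarrow> finite (A first j) \<and> A first j \<noteq> {} \<and> Min (A first j) = 0)"

definition hyperplanes :: "('n::{finite,linorder} \<Rightarrow> 'n \<Rightarrow> real set) \<Rightarrow> (real ^ 'n::{finite,linorder}) set set" where
  "hyperplanes A = {{x \<in> V. x $ i - x $ j = c} | i j c. i < j \<and> c \<in> A i j}"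

definition regions :: "('n::{finite,linorder} \<Rightarrow> 'n \<Rightarrow> real set) \<Rightarrow> (real ^ 'n::{finite,linorder}) set set" where
  "regions A = components (V - \<Union>(hyperplanes A))"

text \<open>\<open>next_in S a\<close> is the successor \<open>a\<^sup>+\<close> of \<open>a\<close> in the finite set \<open>S\<close>.\<close>

definition next_in :: "real set \<Rightarrow> real \<Rightarrow> ereal" where
  "next_in S a = (if \<exists>b\<in>S. a < b then ereal (Min {b \<in> S. a < b}) else \<infinity>)"

text \<open>
  For a generalized Ish arrangement and a region \<open>R\<close>, the set under \<open>Max\<close> is finite and
  contains 0.
\<close>

definition has_code ::
  "('n::{finite,linorder} \<Rightarrow> 'n \<Rightarrow> real set) \<Rightarrow> (real ^ 'n::{finite,linorder}) set \<Rightarrow> ('n \<Rightarrow> 'n) \<Rightarrow> ('n \<Rightarrow> real) \<Rightarrow> bool"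
where
  "has_code A R \<sigma> \<omega> \<longleftrightarrow>
     bij \<sigma> \<and>
     (\<forall>x\<in>R. \<forall>i j. i < j \<longrightarrow> x $ \<sigma> i > x $ \<sigma> j) \<and>
     (\<forall>j. j \<le> inv \<sigma> first \<longrightarrow> \<omega> j = 0) \<and>
     (\<forall>j. j > inv \<sigma> first \<longrightarrow>
        \<omega> j = Max {a \<in> A first (\<sigma> j). \<forall>x\<in>R. x $ first - x $ \<sigma> j > a})"

definition wall ::
  "('n::{finite,linorder} \<Rightarrow> 'n \<Rightarrow> real set) \<Rightarrow> (real ^ 'n::{finite,linorder}) set \<Rightarrow> (real ^ 'n::{finite,linorder}) set \<Rightarrow> bool"
where
  "wall A R H \<longleftrightarrow> H \<in> hyperplanes A \<and> (\<exists>F. F facet_of closure R \<and> H = affine hull F)"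

text \<open>
  Both sides of \<open>H\<close> arise here, by negating \<open>a\<close> and \<open>b\<close>. Only meant for hyperplanes \<open>H\<close> of \<open>V\<close>,
  which determine the pair \<open>(a, b)\<close>, with \<open>a\<close> restricted to \<open>V\<close>, up to a nonzero factor.
\<close>

definition half_spaces :: "(real ^ 'n) set \<Rightarrow> (real ^ 'n) set set" where
  "half_spaces H = {{x \<in> V. a \<bullet> x < b} | a b. H = {x \<in> V. a \<bullet> x = b}}"

definition ceiling_hyperplane ::
  "('n::{finite,linorder} \<Rightarrow> 'n \<Rightarrow> real set) \<Rightarrow> (real ^ 'n::{finite,linorder}) set \<Rightarrow> (real ^ 'n::{finite,linorder}) set \<Rightarrow> bool"
where
  "ceiling_hyperplane A R H \<longleftrightarrow>
     wall A R H \<and> 0 \<notin> H \<and> (\<exists>D \<in> half_spaces H. R \<subseteq> D \<and> 0 \<in> D)"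

end

theory Submission
  imports Defs
begin

text \<open>
  Write \<open>p\<close> for the position of the index 1 in \<open>\<sigma>\<close>. A code determines its region: \<open>R\<close> is the set of
  points of \<open>V\<close> whose coordinates are in the order \<open>\<sigma>\<close> and whose differences
  \<open>y\<^sub>k = x\<^sub>1 - x\<^sub>\<sigma>\<^sub>(\<^sub>k\<^sub>)\<close> satisfy \<open>\<omega>(k) < y\<^sub>k < \<omega>(k)\<^sup>+\<close> for \<open>k > p\<close>
  (\<open>region_eq_code_polyhedron\<close>). Thus \<open>R\<close> is a polyhedron, relatively open in \<open>V\<close>, with an explicit list
  of inequalities, and its walls are the equality hyperplanes of the irredundant ones.

  Every member of the arrangement that avoids the origin has the form \<open>x\<^sub>1 - x\<^sub>\<sigma>\<^sub>(\<^sub>k\<^sub>) = c\<close> with \<open>c > 0\<close>.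
  If it is a ceiling, then \<open>y\<^sub>k < c\<close> on \<open>R\<close>, and since its facet contains points of the closure of \<open>R\<close>
  with \<open>y\<^sub>k = c\<close>, the bound \<open>y\<^sub>k < c\<close> must be the sharp one: \<open>k > p\<close> and \<open>c = \<omega>(k)\<^sup>+\<close>. What remains is
  to decide which of the upper bounds \<open>y\<^sub>k < \<omega>(k)\<^sup>+\<close> define facets. On \<open>R\<close> the \<open>y\<^sub>k\<close> increase with \<open>k\<close>.

  If some \<open>l > k\<close> has \<open>\<omega>(l)\<^sup>+ \<le> \<omega>(k)\<^sup>+ = c\<close>, then \<open>y\<^sub>k = c\<close> in the closure forces
  \<open>c = y\<^sub>k \<le> y\<^sub>l \<le> \<omega>(l)\<^sup>+ \<le> c\<close>, so the face lies in the further hyperplane \<open>y\<^sub>k = y\<^sub>l\<close> and has too small an affine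
  hull (\<open>not_coordinates_tied_on_hyperplane\<close>). If there is no such \<open>l\<close>, then starting from a point of
  \<open>R\<close> one can raise \<open>y\<^sub>k\<close> to \<open>c\<close>, pushing the later \<open>y\<^sub>l\<close> slightly above \<open>c\<close> where necessary, without
  violating any other inequality (\<open>point_on_irredundant_upper_bound\<close>). Such a point witnesses that the
  bound cuts out a facet with the right affine hull (\<open>facet_of_irredundant_constraint\<close>).
\<close>

section \<open>Facets of relatively open polyhedra\<close>

lemma convex_strict_polyhedron:
  fixes U :: "'a::euclidean_space set"
  assumes U: "affine U"
  shows "convex {x \<in> U. \<forall>(a, b) \<in> C. a \<bullet> x < b}"
proof -
  have eq: "{x \<in> U. \<forall>(a, b) \<in> C. a \<bullet> x < b} = U \<inter> (\<Inter>(a, b)\<in>C. {x. a \<bullet> x < b})"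
    by auto
  show ?thesis
    unfolding eq
    by (intro convex_Int affine_imp_convex[OF U]) (auto intro!: convex_INT convex_halfspace_lt)
qed

text \<open>
  A point \<open>z\<close> that satisfies the weak inequalities is the limit, along the segment to any point of \<open>S\<close>, of
  points satisfying the strict ones. Without a point of \<open>S\<close> the equality can fail.
\<close>

lemma closure_strict_polyhedron:
  fixes U :: "'a::euclidean_space set"
  assumes U: "affine U"
    and S: "S = {x \<in> U. \<forall>(a, b) \<in> C. a \<bullet> x < b}"
    and ne: "S \<noteq> {}"
  shows "closure S = {x \<in> U. \<forall>(a, b) \<in> C. a \<bullet> x \<le> b}" (is "_ = ?Q")
proof
  have eq: "?Q = U \<inter> (\<Inter>(a, b)\<in>C. {x. a \<bullet> x \<le> b})"
    by auto
  have "closed ?Q"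
    unfolding eq
    by (intro closed_Int affine_closed[OF U]) (auto intro!: closed_INT closed_halfspace_le)
  moreover have "S \<subseteq> ?Q"
    unfolding S by fastforce
  ultimately show "closure S \<subseteq> ?Q"
    by (simp add: closure_minimal)
next
  show "?Q \<subseteq> closure S"
  proof
    fix z assume z: "z \<in> ?Q"
    obtain x where x: "x \<in> S" using ne by blast
    have in_S: "(1 - t) *\<^sub>R z + t *\<^sub>R x \<in> S" if t: "0 < t" "t \<le> 1" for t :: real
    proof -
      have "(1 - t) *\<^sub>R z + t *\<^sub>R x \<in> U"
        using U x z S by (auto simp: affine_def)
      moreover have "a \<bullet> ((1 - t) *\<^sub>R z + t *\<^sub>R x) < b" if "(a, b) \<in> C" for a b
      proof -
        have "a \<bullet> z \<le> b" "a \<bullet> x < b" using that x z S by auto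
        then have "(1 - t) * (a \<bullet> z) \<le> (1 - t) * b" "t * (a \<bullet> x) < t * b"
          using t by (auto intro: mult_left_mono)
        then show ?thesis by (simp add: inner_add_right algebra_simps)
      qed
      ultimately show ?thesis unfolding S by auto
    qed
    have "((\<lambda>t. (1 - t) *\<^sub>R z + t *\<^sub>R x) \<longlongrightarrow> (1 - 0) *\<^sub>R z + 0 *\<^sub>R x) (at_right (0::real))"
      by (intro tendsto_intros)
    moreover have "\<forall>\<^sub>F t in at_right (0::real). (1 - t) *\<^sub>R z + t *\<^sub>R x \<in> closure S"
      using in_S closure_subset[of S]
      by (intro eventually_at_rightI[of 0 1]) auto
    ultimately show "z \<in> closure S"
      using Lim_in_closed_set[of "closure S" "\<lambda>t. (1 - t) *\<^sub>R z + t *\<^sub>R x" "at_right 0"]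
      by simp
  qed
qed

text \<open>Finitely many strict inequalities cut out a relatively open subset of \<open>U\<close>, which spans \<open>U\<close>.\<close>

lemma affine_hull_strict_polyhedron:
  fixes U :: "'a::euclidean_space set"
  assumes U: "affine U" and fin: "finite C"
    and S: "S = {x \<in> U. \<forall>(a, b) \<in> C. a \<bullet> x < b}"
    and ne: "S \<noteq> {}"
  shows "affine hull S = U"
proof -
  have eq: "S = U \<inter> (\<Inter>(a, b)\<in>C. {x. a \<bullet> x < b})"
    unfolding S by auto
  have "open (\<Inter>(a, b)\<in>C. {x. a \<bullet> x < b})"
    using fin by (auto intro!: open_INT open_halfspace_lt split: prod.splits)
  then have "openin (top_of_set U) S"
    unfolding eq by (simp add: openin_open_Int)
  then show ?thesis
    using affine_hull_openin[of U S] ne U by (simp add: affine_hull_eq[THEN iffD2])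
qed

text \<open>
  The point \<open>q\<close> lies on the bounding hyperplane of one constraint and strictly inside all others. Near \<open>q\<close>
  the face is therefore a relatively open piece of \<open>U \<inter> {x. a \<bullet> x = b}\<close>, so that it spans this set; and
  as the constraint is strict on the nonempty \<open>S\<close>, this set has one dimension less than \<open>U\<close>.
\<close>

lemma facet_of_irredundant_constraint:
  fixes U :: "'a::euclidean_space set"
  assumes U: "affine U" and fin: "finite C"
    and S: "S = {x \<in> U. \<forall>(a, b) \<in> C. a \<bullet> x < b}"
    and ne: "S \<noteq> {}"
    and ab: "(a, b) \<in> C"
    and q: "q \<in> U" "a \<bullet> q = b" "\<And>a' b'. (a', b') \<in> C - {(a, b)} \<Longrightarrow> a' \<bullet> q < b'"
  shows "(closure S \<inter> {x. a \<bullet> x = b}) facet_of closure S"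
    and "affine hull (closure S \<inter> {x. a \<bullet> x = b}) = U \<inter> {x. a \<bullet> x = b}"
proof -
  let ?W = "U \<inter> {x. a \<bullet> x = b}"
  let ?F = "closure S \<inter> {x. a \<bullet> x = b}"
  note cl = closure_strict_polyhedron[OF U S ne]
  define F0 where "F0 = {x \<in> ?W. \<forall>(a', b') \<in> C - {(a, b)}. a' \<bullet> x < b'}"
  have qF0: "q \<in> F0" using q unfolding F0_def by auto
  have W: "affine ?W" by (intro affine_Int U affine_hyperplane)
  have hull0: "affine hull F0 = ?W"
    using qF0 fin by (intro affine_hull_strict_polyhedron[OF W _ F0_def]) auto
  have "F0 \<subseteq> ?F"
  proof
    fix x assume x: "x \<in> F0"
    have "a' \<bullet> x \<le> b'" if "(a', b') \<in> C" for a' b'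
    proof (cases "(a', b') = (a, b)")
      case True
      then show ?thesis using x unfolding F0_def by simp
    next
      case False
      then have "(a', b') \<in> C - {(a, b)}" using that by simp
      then have "a' \<bullet> x < b'" using x unfolding F0_def by blast
      then show ?thesis by simp
    qed
    then show "x \<in> ?F" using x unfolding F0_def cl by auto
  qed
  moreover have "?F \<subseteq> ?W" unfolding cl by auto
  ultimately show hull: "affine hull ?F = ?W"
    using hull0 W by (metis hull_minimal hull_mono subset_antisym)
  have "convex S"
    unfolding S by (rule convex_strict_polyhedron[OF U])
  then have face: "?F face_of closure S"
  proof (intro face_of_Int_supporting_hyperplane_le convex_closure)
    show "a \<bullet> x \<le> b" if "x \<in> closure S" for x using that ab unfolding cl by blast
  qed
  have "aff_dim (closure S) = aff_dim U"
    using affine_hull_strict_polyhedron[OF U fin S ne] by (metis aff_dim_affine_hull closure_aff_dim)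
  moreover have "aff_dim ?F = aff_dim U - 1"
  proof -
    obtain x where "x \<in> S" using ne by blast
    then have "x \<in> U" "a \<bullet> x < b" using ab unfolding S by auto
    then have "\<not> U \<subseteq> {x. a \<bullet> x = b}" by auto
    moreover have "?W \<noteq> {}" using q by auto
    ultimately have "aff_dim ?W = aff_dim U - 1"
      using U by (simp add: aff_dim_affine_Int_hyperplane)
    then show ?thesis using hull by (metis aff_dim_affine_hull)
  qed
  moreover have "?F \<noteq> {}" using qF0 \<open>F0 \<subseteq> ?F\<close> by blast
  ultimately show "?F facet_of closure S"
    using face by (simp add: facet_of_def)
qed

section \<open>The arrangement and its regions\<close>

lemma first_le: "first \<le> i"
  by (simp add: first_def)

lemma first_less_iff: "first < i \<longleftrightarrow> i \<noteq> first"
  using first_le[of i] by auto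

lemma ish_first_row:
  assumes "generalized_ish A" "first < i"
  shows "finite (A first i)" "0 \<in> A first i" "\<And>c. c \<in> A first i \<Longrightarrow> 0 \<le> c"
proof -
  have fin: "finite (A first i)" and ne: "A first i \<noteq> {}" and Min: "Min (A first i) = 0"
    using assms unfolding generalized_ish_def by blast+
  show "finite (A first i)" by fact
  show "0 \<in> A first i" using Min_in[OF fin ne] Min by simp
  show "0 \<le> c" if "c \<in> A first i" for c using Min_le[OF fin that] Min by simp
qed

lemma affine_V: "affine V"
  by (auto simp: affine_def V_def sum.distrib simp flip: sum_distrib_left)

text \<open>
  All constraints other than membership in \<open>V\<close> only involve differences of coordinates, so points may be
  built freely in the full space and then translated along \<open>(1,\<dots>,1)\<close> into \<open>V\<close>.
\<close>

lemma centering: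
  obtains z where "z \<in> V" "\<And>i j. z $ i - z $ j = y $ i - y $ j"
proof
  let ?z = "\<chi> i. y $ i - (\<Sum>i\<in>UNIV. y $ i) / real CARD('a)"
  show "?z \<in> V" by (simp add: V_def sum_subtractf)
  show "?z $ i - ?z $ j = y $ i - y $ j" for i j by simp
qed

lemma next_in_eq_ereal:
  assumes "finite S" "next_in S a = ereal c"
  shows "c \<in> S" "a < c"
proof -
  have ex: "\<exists>b\<in>S. a < b" and c: "c = Min {b \<in> S. a < b}"
    using assms(2) by (auto simp: next_in_def split: if_splits)
  have "c \<in> {b \<in> S. a < b}"
    unfolding c using assms(1) ex by (intro Min_in) auto
  then show "c \<in> S" "a < c" by auto
qed

lemma next_in_le:
  assumes "finite S" "b \<in> S" "a < b"
  shows "next_in S a \<le> ereal b"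
  using assms by (auto simp: next_in_def)

lemma next_in_cases:
  obtains (fin) c where "next_in S a = ereal c" | (inf) "next_in S a = \<infinity>"
  unfolding next_in_def by (cases "\<exists>b\<in>S. a < b") simp_all

text \<open>
  A pair \<open>(a, b)\<close> stands for \<open>a \<bullet> x < b\<close>; positions with \<open>\<omega>(k)\<^sup>+ = \<infinity>\<close> contribute no upper bound, which
  keeps the right-hand sides real.
\<close>

definition code_constraints ::
  "('n::{finite,linorder} \<Rightarrow> 'n \<Rightarrow> real set) \<Rightarrow> ('n \<Rightarrow> 'n) \<Rightarrow> ('n \<Rightarrow> real) \<Rightarrow> ((real ^ 'n::{finite,linorder}) \<times> real) set"
where
  "code_constraints A \<sigma> \<omega> =
     {(axis (\<sigma> l) 1 - axis (\<sigma> k) 1, 0) | k l. k < l} \<union>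
     {(axis (\<sigma> k) 1 - axis first 1, - \<omega> k) | k. inv \<sigma> first < k} \<union>
     {(axis first 1 - axis (\<sigma> k) 1, c) | k c. inv \<sigma> first < k \<and> next_in (A first (\<sigma> k)) (\<omega> k) = ereal c}"

lemma code_constraints_cases:
  assumes "(a, b) \<in> code_constraints A \<sigma> \<omega>"
  obtains (ord) k l where "k < l" "a = axis (\<sigma> l) 1 - axis (\<sigma> k) 1" "b = 0"
  | (low) k where "inv \<sigma> first < k" "a = axis (\<sigma> k) 1 - axis first 1" "b = - \<omega> k"
  | (up) k where "inv \<sigma> first < k" "a = axis first 1 - axis (\<sigma> k) 1"
      "next_in (A first (\<sigma> k)) (\<omega> k) = ereal b"
  using assms unfolding code_constraints_def by blast

lemma inner_axis_diff: "(axis i 1 - axis j 1) \<bullet> x = x $ i - (x $ j :: real)"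
  by (simp add: inner_diff_left inner_axis')

lemma finite_code_constraints: "finite (code_constraints A \<sigma> \<omega>)"
proof -
  let ?c = "\<lambda>k. real_of_ereal (next_in (A first (\<sigma> k)) (\<omega> k))"
  have "code_constraints A \<sigma> \<omega> \<subseteq>
      (\<lambda>(k, l). (axis (\<sigma> l) 1 - axis (\<sigma> k) 1, 0)) ` UNIV \<union>
      (\<lambda>k. (axis (\<sigma> k) 1 - axis first 1, - \<omega> k)) ` UNIV \<union>
      (\<lambda>k. (axis first 1 - axis (\<sigma> k) 1, ?c k)) ` UNIV" (is "_ \<subseteq> ?O \<union> ?L \<union> ?U")
  proof
    fix u assume "u \<in> code_constraints A \<sigma> \<omega>"
    moreover obtain a b where u: "u = (a, b)" by fastforce
    ultimately have "(a, b) \<in> code_constraints A \<sigma> \<omega>" by simp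
    then show "u \<in> ?O \<union> ?L \<union> ?U"
    proof (cases rule: code_constraints_cases)
      case (ord k l)
      then have "u = (\<lambda>(k, l). (axis (\<sigma> l) 1 - axis (\<sigma> k) 1, 0)) (k, l)" using u by simp
      then show ?thesis by blast
    next
      case (low k)
      then show ?thesis using u by blast
    next
      case (up k)
      then have "u = (axis first 1 - axis (\<sigma> k) 1, ?c k)" using u by simp
      then show ?thesis by blast
    qed
  qed
  then show ?thesis by (rule finite_subset) simp
qed

lemma strict_code_constraints_iff:
  "(\<forall>(a, b) \<in> code_constraints A \<sigma> \<omega>. a \<bullet> x < b) \<longleftrightarrow>
     (\<forall>k l. k < l \<longrightarrow> x $ \<sigma> l < x $ \<sigma> k) \<and>
     (\<forall>k > inv \<sigma> first. \<omega> k < x $ first - x $ \<sigma> k \<and>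
        ereal (x $ first - x $ \<sigma> k) < next_in (A first (\<sigma> k)) (\<omega> k))" (is "?L \<longleftrightarrow> ?R")
proof
  assume L: ?L
  have 1: "x $ \<sigma> l < x $ \<sigma> k" if "k < l" for k l
  proof -
    have "(axis (\<sigma> l) 1 - axis (\<sigma> k) 1, 0) \<in> code_constraints A \<sigma> \<omega>"
      using that unfolding code_constraints_def by blast
    then show ?thesis using L by (fastforce simp: inner_axis_diff)
  qed
  have 2: "\<omega> k < x $ first - x $ \<sigma> k" if "inv \<sigma> first < k" for k
  proof -
    have "(axis (\<sigma> k) 1 - axis first 1, - \<omega> k) \<in> code_constraints A \<sigma> \<omega>"
      using that unfolding code_constraints_def by auto
    then show ?thesis using L by (fastforce simp: inner_axis_diff)
  qed
  have 3: "ereal (x $ first - x $ \<sigma> k) < next_in (A first (\<sigma> k)) (\<omega> k)" if "inv \<sigma> first < k" for k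
  proof (cases rule: next_in_cases[of "A first (\<sigma> k)" "\<omega> k"])
    case (fin c)
    then have "(axis first 1 - axis (\<sigma> k) 1, c) \<in> code_constraints A \<sigma> \<omega>"
      using that unfolding code_constraints_def by auto
    then show ?thesis using L fin by (fastforce simp: inner_axis_diff)
  qed simp
  show ?R using 1 2 3 by blast
next
  assume R: ?R
  have "a \<bullet> x < b" if "(a, b) \<in> code_constraints A \<sigma> \<omega>" for a b
    using that
  proof (cases rule: code_constraints_cases)
    case (ord k l)
    then show ?thesis using R by (simp add: inner_axis_diff)
  next
    case (low k)
    then have "\<omega> k < x $ first - x $ \<sigma> k" using R by blast
    then show ?thesis using low by (simp add: inner_axis_diff)
  next
    case (up k)
    then have "ereal (x $ first - x $ \<sigma> k) < ereal b" using R by metis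
    then show ?thesis using up by (simp add: inner_axis_diff)
  qed
  then show ?L by blast
qed

text \<open>
  That \<open>R\<close> satisfies the upper bounds uses connectedness: by maximality of \<open>\<omega> k\<close>, the difference
  \<open>x\<^sub>1 - x\<^sub>\<sigma>\<^sub>(\<^sub>k\<^sub>)\<close> does not exceed \<open>\<omega>(k)\<^sup>+\<close> everywhere on \<open>R\<close>, and it cannot take the value \<open>\<omega>(k)\<^sup>+\<close>.
  Conversely, the constraints are incompatible with every hyperplane of the arrangement, so the convex
  set that they define stays inside one component.
\<close>

lemma region_eq_code_polyhedron:
  assumes ish: "generalized_ish A" and R: "R \<in> regions A" and code: "has_code A R \<sigma> \<omega>"
  shows "R = {x \<in> V. \<forall>(a, b) \<in> code_constraints A \<sigma> \<omega>. a \<bullet> x < b}" (is "R = ?P")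
proof -
  let ?p = "inv \<sigma> first"
  have bij: "bij \<sigma>"
    and ord: "\<And>x i j. x \<in> R \<Longrightarrow> i < j \<Longrightarrow> x $ \<sigma> j < x $ \<sigma> i"
    and om: "\<And>k. ?p < k \<Longrightarrow>
        \<omega> k = Max {a \<in> A first (\<sigma> k). \<forall>x\<in>R. x $ first - x $ \<sigma> k > a}"
    using code by (auto simp: has_code_def)
  have \<sigma>p: "\<sigma> ?p = first" by (simp add: bij bij_is_surj surj_f_inv_f)
  have comp: "R \<in> components (V - \<Union>(hyperplanes A))" using R by (simp add: regions_def)
  have RV: "R \<subseteq> V - \<Union>(hyperplanes A)" and Rne: "R \<noteq> {}" and Rconn: "connected R"
    using comp in_components_subset in_components_nonempty in_components_connected by blast+
  have \<sigma>first: "first < \<sigma> k" if "k \<noteq> ?p" for k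
    using that bij by (metis first_less_iff bij_inv_eq_iff)
  have Afin: "finite (A first (\<sigma> k))" and A0: "0 \<in> A first (\<sigma> k)"
    and Age: "\<And>c. c \<in> A first (\<sigma> k) \<Longrightarrow> 0 \<le> c" if "k \<noteq> ?p" for k
    using ish_first_row[OF ish \<sigma>first[OF that]] by auto
  have "R \<subseteq> ?P"
  proof
    fix x assume x: "x \<in> R"
    have low: "\<omega> k < x $ first - x $ \<sigma> k" if k: "?p < k" for k
    proof -
      have "\<omega> k \<in> {a \<in> A first (\<sigma> k). \<forall>x\<in>R. x $ first - x $ \<sigma> k > a}"
      proof -
        have "0 \<in> {a \<in> A first (\<sigma> k). \<forall>x\<in>R. x $ first - x $ \<sigma> k > a}"
          using k A0[of k] ord[OF _ k] \<sigma>p by auto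
        then show ?thesis unfolding om[OF k] using Afin[of k] k by (intro Max_in) auto
      qed
      then show ?thesis using x by blast
    qed
    have up: "ereal (x $ first - x $ \<sigma> k) < next_in (A first (\<sigma> k)) (\<omega> k)" if k: "?p < k" for k
    proof (cases rule: next_in_cases[of "A first (\<sigma> k)" "\<omega> k"])
      case (fin c)
      have c: "c \<in> A first (\<sigma> k)" "\<omega> k < c"
        using next_in_eq_ereal[OF _ fin] Afin k by auto
      have "\<exists>y\<in>R. y $ first - y $ \<sigma> k \<le> c"
      proof (rule ccontr)
        assume "\<not> ?thesis"
        then have "c \<le> \<omega> k"
          unfolding om[OF k] using c Afin[of k] k by (intro Max_ge) auto
        then show False using c by simp
      qed
      then obtain y where y: "y \<in> R" "y $ first - y $ \<sigma> k \<le> c" by blast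
      have "x $ first - x $ \<sigma> k < c"
      proof (rule ccontr)
        assume "\<not> ?thesis"
        then obtain z where "z \<in> R" "z $ first - z $ \<sigma> k = c"
          using connected_ivt_hyperplane[OF Rconn y(1) x, of "axis first 1 - axis (\<sigma> k) 1" c] y(2)
          by (auto simp: inner_axis_diff)
        moreover have "{x \<in> V. x $ first - x $ \<sigma> k = c} \<in> hyperplanes A"
          unfolding hyperplanes_def using c \<sigma>first[of k] k by blast
        ultimately show False using RV by blast
      qed
      then show ?thesis using fin by simp
    qed simp
    show "x \<in> ?P" using x RV ord low up by (simp add: strict_code_constraints_iff) blast
  qed
  moreover have "?P \<subseteq> R"
  proof (rule components_maximal[OF comp])
    show "connected ?P"
      by (intro convex_connected convex_strict_polyhedron affine_V)
    show "R \<inter> ?P \<noteq> {}" using \<open>R \<subseteq> ?P\<close> Rne by blast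
    show "?P \<subseteq> V - \<Union>(hyperplanes A)"
    proof
      fix x assume x: "x \<in> ?P"
      then have xV: "x \<in> V" and xord: "\<And>k l. k < l \<Longrightarrow> x $ \<sigma> l < x $ \<sigma> k"
        and low: "\<And>k. ?p < k \<Longrightarrow> \<omega> k < x $ first - x $ \<sigma> k"
        and up: "\<And>k. ?p < k \<Longrightarrow> ereal (x $ first - x $ \<sigma> k) < next_in (A first (\<sigma> k)) (\<omega> k)"
        by (auto simp: strict_code_constraints_iff)
      have False if ij: "i < j" "c \<in> A i j" "x $ i - x $ j = c" for i j c
      proof (cases "i = first")
        case False
        then have "first < i" by (simp add: first_less_iff)
        then have c0: "c = 0" using ish ij by (auto simp: generalized_ish_def)
        obtain k l where kl: "i = \<sigma> k" "j = \<sigma> l" using bij by (metis bij_pointE)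
        then have "k \<noteq> l" using ij by auto
        then show False using xord[of k l] xord[of l k] kl c0 ij(3) by (metis less_irrefl linorder_neqE right_minus_eq)
      next
        case True
        obtain k where k: "j = \<sigma> k" using bij by (metis bij_pointE)
        have kp: "k \<noteq> ?p" using ij k True \<sigma>p by auto
        show False
        proof (cases "k < ?p")
          case less: True
          then show False using xord[OF less] Age[OF kp, of c] ij True k \<sigma>p by simp
        next
          case False
          then have gt: "?p < k" using kp by simp
          have "\<omega> k < c" using low[OF gt] ij True k by simp
          then have "next_in (A first (\<sigma> k)) (\<omega> k) \<le> ereal c"
            using ij True k Afin[OF kp] by (intro next_in_le) auto
          then show False using up[OF gt] ij True k by simp
        qed
      qed
      then show "x \<in> V - \<Union>(hyperplanes A)" using xV by (auto simp: hyperplanes_def)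
    qed
  qed
  ultimately show ?thesis by blast
qed

section \<open>Upper bounds that define facets\<close>

text \<open>
  The point is obtained from \<open>x\<close> by applying to all coordinates one strictly increasing function \<open>\<phi>\<close> that
  lies below the identity. Monotonicity preserves the order of the coordinates and \<open>\<phi> t \<le> t\<close> preserves
  the lower bounds. Above \<open>x\<^sub>\<sigma>\<^sub>(\<^sub>j\<^sub>)\<close>, in particular at \<open>x\<^sub>1\<close>, \<open>\<phi>\<close> is the identity, it moves \<open>x\<^sub>\<sigma>\<^sub>(\<^sub>j\<^sub>)\<close> down to
  \<open>x\<^sub>1 - c\<close>, and below it moves values no further than to slightly less than \<open>x\<^sub>1 - c\<close>, which the later
  upper bounds tolerate because they are larger than \<open>c\<close>.
\<close>

lemma point_on_irredundant_upper_bound: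
  assumes x: "\<forall>(a, b) \<in> code_constraints A \<sigma> \<omega>. a \<bullet> x < b"
    and bij: "bij \<sigma>" and j: "inv \<sigma> first < j"
    and c: "next_in (A first (\<sigma> j)) (\<omega> j) = ereal c"
    and irr: "\<And>k. j < k \<Longrightarrow> ereal c < next_in (A first (\<sigma> k)) (\<omega> k)"
  obtains z where "z \<in> V" "(axis first 1 - axis (\<sigma> j) 1) \<bullet> z = c"
    "\<And>a b. (a, b) \<in> code_constraints A \<sigma> \<omega> - {(axis first 1 - axis (\<sigma> j) 1, c)} \<Longrightarrow> a \<bullet> z < b"
proof -
  have xord: "\<And>k l. k < l \<Longrightarrow> x $ \<sigma> l < x $ \<sigma> k"
    and low: "\<And>k. inv \<sigma> first < k \<Longrightarrow> \<omega> k < x $ first - x $ \<sigma> k"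
    and up: "\<And>k. inv \<sigma> first < k \<Longrightarrow> ereal (x $ first - x $ \<sigma> k) < next_in (A first (\<sigma> k)) (\<omega> k)"
    using x by (auto simp: strict_code_constraints_iff)
  have \<sigma>p: "\<sigma> (inv \<sigma> first) = first" by (simp add: bij bij_is_surj surj_f_inv_f)
  have x1: "x $ \<sigma> j < x $ first" using xord[OF j] \<sigma>p by simp
  have xc: "x $ first - x $ \<sigma> j < c" using up[OF j] c by simp
  \<comment> \<open>The slope \<open>e\<close> keeps the lowered coordinates distinct. There are finitely many later bounds, all
      larger than \<open>c\<close>, so a small enough slope respects them.\<close>
  let ?gap = "\<lambda>k. x $ \<sigma> j - x $ \<sigma> k"
  have "\<forall>\<^sub>F e in at_right (0::real). ereal (c + e * ?gap k) < next_in (A first (\<sigma> k)) (\<omega> k)"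
    if "k \<in> {j<..}" for k
  proof -
    have "((\<lambda>e. ereal (c + e * ?gap k)) \<longlongrightarrow> ereal (c + 0 * ?gap k)) (at_right (0::real))"
      by (intro tendsto_intros)
    then show ?thesis using irr[of k] that by (intro order_tendstoD(2)[where y = "ereal (c + 0 * ?gap k)"]) auto
  qed
  then have "\<forall>\<^sub>F e in at_right (0::real). \<forall>k\<in>{j<..}. ereal (c + e * ?gap k) < next_in (A first (\<sigma> k)) (\<omega> k)"
    by (intro eventually_ball_finite) auto
  then have "\<forall>\<^sub>F e in at_right (0::real). 0 < e \<and>
      (\<forall>k\<in>{j<..}. ereal (c + e * ?gap k) < next_in (A first (\<sigma> k)) (\<omega> k))"
    using eventually_at_right_less[of "0::real"] by eventually_elim auto
  then obtain e :: real where e: "0 < e"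
    and eup: "\<And>k. j < k \<Longrightarrow> ereal (c + e * ?gap k) < next_in (A first (\<sigma> k)) (\<omega> k)"
    using eventually_happens'[of "at_right (0::real)"] by force
  define \<phi> where "\<phi> t = (if x $ \<sigma> j < t then t else min t (x $ first - c - e * (x $ \<sigma> j - t)))" for t
  have \<phi>_mono: "\<phi> s < \<phi> t" if "s < t" for s t
  proof -
    have "e * s < e * t" using that e by simp
    then show ?thesis using that unfolding \<phi>_def by (auto simp: min_def right_diff_distrib)
  qed
  have \<phi>_le: "\<phi> t \<le> t" for t unfolding \<phi>_def by auto
  have \<phi>1: "\<phi> (x $ first) = x $ first" using x1 by (simp add: \<phi>_def)
  have \<phi>j: "\<phi> (x $ \<sigma> j) = x $ first - c" using xc by (simp add: \<phi>_def)
  obtain z where zV: "z \<in> V" and zd: "\<And>i k. z $ i - z $ k = \<phi> (x $ i) - \<phi> (x $ k)"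
    using centering[of "\<chi> i. \<phi> (x $ i)"] by auto
  have zup: "ereal (z $ first - z $ \<sigma> k) < next_in (A first (\<sigma> k)) (\<omega> k)"
    if k: "inv \<sigma> first < k" "k \<noteq> j" for k
  proof (cases "k < j")
    case True
    then have "\<phi> (x $ \<sigma> k) = x $ \<sigma> k" using xord by (simp add: \<phi>_def)
    then show ?thesis using zd[of first "\<sigma> k"] \<phi>1 up[OF k(1)] by simp
  next
    case False
    then have jk: "j < k" using k by simp
    then have "\<phi> (x $ \<sigma> k) = min (x $ \<sigma> k) (x $ first - c - e * ?gap k)"
      using xord[OF jk] by (simp add: \<phi>_def)
    then have "z $ first - z $ \<sigma> k = max (x $ first - x $ \<sigma> k) (c + e * ?gap k)"
      using zd[of first "\<sigma> k"] \<phi>1 by auto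
    then show ?thesis using up[OF k(1)] eup[OF jk] by (simp add: max_def)
  qed
  show thesis
  proof
    show "z \<in> V" by fact
    show "(axis first 1 - axis (\<sigma> j) 1) \<bullet> z = c"
      using zd[of first "\<sigma> j"] \<phi>1 \<phi>j by (simp add: inner_axis_diff)
    fix a b assume ab: "(a, b) \<in> code_constraints A \<sigma> \<omega> - {(axis first 1 - axis (\<sigma> j) 1, c)}"
    then have "(a, b) \<in> code_constraints A \<sigma> \<omega>" by blast
    then show "a \<bullet> z < b"
    proof (cases rule: code_constraints_cases)
      case (ord k l)
      then show ?thesis using zd[of "\<sigma> l" "\<sigma> k"] \<phi>_mono[OF xord[OF ord(1)]]
        by (simp add: inner_axis_diff)
    next
      case low': (low k)
      then show ?thesis using zd[of "\<sigma> k" first] low[OF low'(1)] \<phi>_le[of "x $ \<sigma> k"] \<phi>1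
        by (simp add: inner_axis_diff)
    next
      case up': (up k)
      have "k \<noteq> j" using up' ab c by auto
      then show ?thesis using zup[OF up'(1)] up' by (simp add: inner_axis_diff)
    qed
  qed
qed

text \<open>
  Adding \<open>e\<^sub>i + e\<^sub>j - 2e\<^sub>l\<close> stays in \<open>V\<close> and does not change \<open>x\<^sub>i - x\<^sub>j\<close>, but it changes \<open>x\<^sub>j - x\<^sub>l\<close>.
\<close>

lemma not_coordinates_tied_on_hyperplane:
  assumes "h \<in> V" "h $ i - h $ j = (c::real)" "i \<noteq> j" "l \<noteq> i" "l \<noteq> j"
  shows "\<not> {x \<in> V. x $ i - x $ j = c} \<subseteq> {x. x $ j = x $ l}"
proof
  assume tied: "{x \<in> V. x $ i - x $ j = c} \<subseteq> {x. x $ j = x $ l}"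
  define h' where "h' = h + (axis i 1 + axis j 1 - 2 *\<^sub>R axis l 1)"
  have "(\<Sum>k\<in>UNIV. axis m (1::real) $ k) = 1" for m :: 'a
    by (simp add: axis_def)
  then have "h' \<in> V"
    using assms(1) by (simp add: V_def h'_def sum.distrib sum_subtractf flip: sum_distrib_left)
  moreover have "h' $ i - h' $ j = c"
    using assms by (simp add: h'_def axis_def)
  ultimately have "h' $ j = h' $ l" using tied by auto
  moreover have "h $ j = h $ l" using assms tied by auto
  ultimately show False using assms by (simp add: h'_def axis_def)
qed

section \<open>Ceilings\<close>

theorem proposition7p16:
  fixes A :: "'n::{finite,linorder} \<Rightarrow> 'n \<Rightarrow> real set"
    and R H :: "(real ^ 'n::{finite,linorder}) set"
    and \<sigma> :: "'n \<Rightarrow> 'n"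
    and \<omega> :: "'n \<Rightarrow> real"
  assumes "generalized_ish A"
    and "R \<in> regions A"
    and "has_code A R \<sigma> \<omega>"
  shows "ceiling_hyperplane A R H \<longleftrightarrow>
    (\<exists>j. inv \<sigma> first < j \<and> next_in (A first (\<sigma> j)) (\<omega> j) < \<infinity> \<and>
         \<not> (\<exists>j'. j < j' \<and>
               next_in (A first (\<sigma> j)) (\<omega> j) \<ge> next_in (A first (\<sigma> j')) (\<omega> j')) \<and>
         H = {x \<in> V. ereal (x $ first - x $ \<sigma> j) = next_in (A first (\<sigma> j)) (\<omega> j)})"
proof -
  let ?p = "inv \<sigma> first"
  let ?C = "code_constraints A \<sigma> \<omega>"
  let ?next = "\<lambda>k. next_in (A first (\<sigma> k)) (\<omega> k)"
  have bij: "bij \<sigma>" using assms(3) by (simp add: has_code_def)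
  have \<sigma>p: "\<sigma> ?p = first" by (simp add: bij bij_is_surj surj_f_inv_f)
  have inj: "\<sigma> k = \<sigma> l \<longleftrightarrow> k = l" for k l using bij by (metis bij_pointE)
  have \<sigma>first: "first < \<sigma> k" if "k \<noteq> ?p" for k
    using that inj[of k ?p] \<sigma>p by (simp add: first_less_iff)
  note row = ish_first_row[OF assms(1)]
  note R = region_eq_code_polyhedron[OF assms]
  have Rne: "R \<noteq> {}" using assms(2) in_components_nonempty unfolding regions_def by blast
  then obtain x0 where x0: "x0 \<in> R" by blast
  have RV: "R \<subseteq> V" and Rord: "\<And>x k l. x \<in> R \<Longrightarrow> k < l \<Longrightarrow> x $ \<sigma> l < x $ \<sigma> k"
    and Rlow: "\<And>x k. x \<in> R \<Longrightarrow> ?p < k \<Longrightarrow> \<omega> k < x $ first - x $ \<sigma> k"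
    and Rup: "\<And>x k. x \<in> R \<Longrightarrow> ?p < k \<Longrightarrow> ereal (x $ first - x $ \<sigma> k) < ?next k"
    unfolding R by (auto simp: strict_code_constraints_iff)
  have cl_le: "a \<bullet> x \<le> b" if "x \<in> closure R" "\<And>y. y \<in> R \<Longrightarrow> a \<bullet> y < b" for a x b
  proof -
    have "closure R \<subseteq> {x. a \<bullet> x \<le> b}"
      using that(2) by (intro closure_minimal closed_halfspace_le) (auto simp: less_imp_le)
    then show ?thesis using that(1) by auto
  qed
  have \<omega>_ge: "0 \<le> \<omega> k" if k: "?p < k" for k
  proof -
    let ?M = "{a \<in> A first (\<sigma> k). \<forall>x\<in>R. x $ first - x $ \<sigma> k > a}"
    have f: "first < \<sigma> k" using \<sigma>first[of k] k by simp
    have "0 \<in> ?M" using row(2)[OF f] Rord[OF _ k] \<sigma>p by auto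
    moreover have "\<omega> k = Max ?M" using assms(3) k by (simp add: has_code_def)
    ultimately show ?thesis using row(1)[OF f] by (simp add: Max_ge)
  qed
  show ?thesis
  proof
    assume ceil: "ceiling_hyperplane A R H"
    then obtain F D where F: "F facet_of closure R" "H = affine hull F"
      and H0: "0 \<notin> H" and D: "D \<in> half_spaces H" "R \<subseteq> D" "0 \<in> D" and Hh: "H \<in> hyperplanes A"
      by (auto simp: ceiling_hyperplane_def wall_def)
    obtain i m c where im: "i < m" "c \<in> A i m" and H: "H = {x \<in> V. x $ i - x $ m = c}"
      using Hh by (auto simp: hyperplanes_def)
    have "c \<noteq> 0" using H0 H by (auto simp: V_def)
    then have i: "i = first"
      using assms(1) im by (metis first_less_iff generalized_ish_def singletonD)
    then have cpos: "0 < c" using row(3)[of m c] im i \<open>c \<noteq> 0\<close> by auto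
    obtain k where k: "m = \<sigma> k" using bij by (metis bij_pointE)
    have kp: "k \<noteq> ?p" using k im i \<sigma>p by auto
    \<comment> \<open>The convex half-space \<open>D\<close> misses \<open>H\<close> and contains the origin, where the difference is \<open>0 < c\<close>.\<close>
    have RH: "x $ first - x $ \<sigma> k < c" if x: "x \<in> R" for x
    proof (rule ccontr)
      assume "\<not> ?thesis"
      moreover obtain a b where a: "D = {x \<in> V. a \<bullet> x < b}" "H = {x \<in> V. a \<bullet> x = b}"
        using D(1) by (auto simp: half_spaces_def)
      have eqD: "D = V \<inter> {x. a \<bullet> x < b}" using a by auto
      have "convex D"
        unfolding eqD by (intro convex_Int affine_imp_convex affine_V convex_halfspace_lt)
      then have "connected D" by (rule convex_connected)
      ultimately obtain z where "z \<in> D" "z $ first - z $ \<sigma> k = c"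
        using connected_ivt_hyperplane[of D 0 x "axis first 1 - axis (\<sigma> k) 1" c] D x cpos
        by (auto simp: inner_axis_diff)
      then show False using a H i k by auto
    qed
    have "F \<noteq> {}" using F(1) by (simp add: facet_of_def)
    moreover have "F \<subseteq> closure R" using F(1) by (rule facet_of_imp_subset)
    moreover have FH: "F \<subseteq> H" unfolding F(2) by (rule hull_subset)
    ultimately obtain f where f: "f \<in> closure R" "f \<in> H" by blast
    have fc: "f $ first - f $ \<sigma> k = c" using f H i k by simp
    have pk: "?p < k"
    proof (rule ccontr)
      assume "\<not> ?thesis"
      then have "k < ?p" using kp by simp
      then have "(axis first 1 - axis (\<sigma> k) 1) \<bullet> f \<le> 0"
        using Rord[of _ k ?p] \<sigma>p by (intro cl_le[OF f(1)]) (simp add: inner_axis_diff)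
      then show False using fc cpos by (simp add: inner_axis_diff)
    qed
    have "\<omega> k < c" using Rlow[OF x0 pk] RH[OF x0] by simp
    then have nle: "?next k \<le> ereal c"
      using im i k row(1)[of m] by (intro next_in_le) auto
    then obtain d where d: "?next k = ereal d"
      by (cases rule: next_in_cases[of "A first (\<sigma> k)" "\<omega> k"]) auto
    have "(axis first 1 - axis (\<sigma> k) 1) \<bullet> f \<le> d"
      using Rup[OF _ pk] d by (intro cl_le[OF f(1)]) (simp add: inner_axis_diff)
    \<comment> \<open>The bound \<open>\<omega>(k)\<^sup>+\<close> persists on the closure and so cannot be smaller than the value \<open>c\<close> attained at \<open>f\<close>.\<close>
    then have nk: "?next k = ereal c" using d nle fc by (simp add: inner_axis_diff)
    have "\<not> ?next l \<le> ?next k" if l: "k < l" for l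
    proof
      assume le: "?next l \<le> ?next k"
      then obtain d where d: "?next l = ereal d" "d \<le> c"
        using nk by (cases rule: next_in_cases[of "A first (\<sigma> l)" "\<omega> l"]) auto
      have "F \<subseteq> {x. x $ \<sigma> k = x $ \<sigma> l}"
      proof
        fix x assume x: "x \<in> F"
        then have xR: "x \<in> closure R" and xc: "x $ first - x $ \<sigma> k = c"
          using \<open>F \<subseteq> closure R\<close> FH H i k by auto
        have "(axis first 1 - axis (\<sigma> l) 1) \<bullet> x \<le> d"
          using Rup[of _ l] d pk l by (intro cl_le[OF xR]) (simp add: inner_axis_diff)
        moreover have "(axis (\<sigma> l) 1 - axis (\<sigma> k) 1) \<bullet> x \<le> 0"
          using Rord[OF _ l] by (intro cl_le[OF xR]) (simp add: inner_axis_diff)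
        ultimately show "x \<in> {x. x $ \<sigma> k = x $ \<sigma> l}"
          using xc d by (simp add: inner_axis_diff)
      qed
      moreover have "affine {x. x $ \<sigma> k = x $ \<sigma> l}"
        by (simp add: affine_def)
      ultimately have "H \<subseteq> {x. x $ \<sigma> k = x $ \<sigma> l}"
        unfolding F(2) by (rule hull_minimal)
      then show False
        using not_coordinates_tied_on_hyperplane[of f first "\<sigma> k" c "\<sigma> l"]
          f(2) H i k less_imp_neq[OF im(1)] inj[of l k] inj[of l ?p] \<sigma>p pk l by auto
    qed
    then show "\<exists>j. ?p < j \<and> ?next j < \<infinity> \<and> \<not> (\<exists>j'. j < j' \<and> ?next j \<ge> ?next j') \<and>
         H = {x \<in> V. ereal (x $ first - x $ \<sigma> j) = ?next j}"
      using pk nk H i k by (intro exI[of _ k]) auto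
  next
    assume "\<exists>j. ?p < j \<and> ?next j < \<infinity> \<and> \<not> (\<exists>j'. j < j' \<and> ?next j \<ge> ?next j') \<and>
         H = {x \<in> V. ereal (x $ first - x $ \<sigma> j) = ?next j}"
    then obtain j where j: "?p < j" and fin: "?next j < \<infinity>"
      and irr: "\<And>k. j < k \<Longrightarrow> ?next j < ?next k"
      and H: "H = {x \<in> V. ereal (x $ first - x $ \<sigma> j) = ?next j}"
      by (auto simp: not_le)
    obtain c where c: "?next j = ereal c"
      using fin by (cases rule: next_in_cases[of "A first (\<sigma> j)" "\<omega> j"]) auto
    let ?a = "axis first 1 - axis (\<sigma> j) (1::real)"
    have Hc: "H = {x \<in> V. x $ first - x $ \<sigma> j = c}" using H c by simp
    then have Ha: "H = V \<inter> {x. ?a \<bullet> x = c}" by (auto simp: inner_axis_diff)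
    have f: "first < \<sigma> j" using \<sigma>first[of j] j by simp
    have cA: "c \<in> A first (\<sigma> j)" "\<omega> j < c" using next_in_eq_ereal[OF row(1)[OF f] c] .
    have cpos: "0 < c" using cA \<omega>_ge[OF j] by simp
    have "\<forall>(a, b) \<in> ?C. a \<bullet> x0 < b" using x0 R by blast
    then obtain z where z: "z \<in> V" "?a \<bullet> z = c"
      "\<And>a b. (a, b) \<in> ?C - {(?a, c)} \<Longrightarrow> a \<bullet> z < b"
      using point_on_irredundant_upper_bound[of A \<sigma> \<omega> x0 j c] bij j c irr by metis
    have "(?a, c) \<in> ?C" using j c unfolding code_constraints_def by blast
    note facet = facet_of_irredundant_constraint[OF affine_V finite_code_constraints R Rne this z]
    have "H \<in> hyperplanes A" unfolding hyperplanes_def Hc using f cA by blast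
    then have "wall A R H" unfolding wall_def using facet Ha by metis
    moreover have "0 \<notin> H" using Hc cpos by auto
    moreover have "{x \<in> V. ?a \<bullet> x < c} \<in> half_spaces H"
      unfolding half_spaces_def using Ha by blast
    moreover have "R \<subseteq> {x \<in> V. ?a \<bullet> x < c}"
      using RV Rup[OF _ j] c by (auto simp: inner_axis_diff)
    moreover have "0 \<in> {x \<in> V. ?a \<bullet> x < c}" using cpos by (simp add: V_def)
    ultimately show "ceiling_hyperplane A R H" unfolding ceiling_hyperplane_def by blast
  qed
qed

end
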